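(* Let $L$ be a lattice all of whose chains are finite. Then any two $2$-uniform congruences $\alpha$ and $\beta$ of $L$ permute, that is, $\alpha\circ\beta=\beta\circ\alpha$.
   Context: A $2$-uniform congruence on a lattice is a lattice congruence each of whose blocks (congruence classes) consists of exactly two elements; equivalently, it is a $2$-uniform tolerance that is a congruence. The product is $\alpha\circ\beta=\{(x,z): \text{there exists } y\in L \text{ with } (x,y)\in\alpha \text{ and } (y,z)\in\beta\}$. *)

theory Defs
  imports Main
begin

definition lattice_congruence :: "('a::lattice \<times> 'a) set \<Rightarrow> bool" where
  "lattice_congruence \<theta> \<longleftrightarrow> equiv UNIV \<theta> \<and>
     (\<forall>a b c d. (a, b) \<in> \<theta> \<longrightarrow> (c, d) \<in> \<theta> \<longrightarrow>
        (sup a c, sup b d) \<in> \<theta> \<and> (inf a c, inf b d) \<in> \<theta>)"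

definition two_uniform_congruence :: "('a::lattice \<times> 'a) set \<Rightarrow> bool" where
  "two_uniform_congruence \<theta> \<longleftrightarrow> lattice_congruence \<theta> \<and> (\<forall>B \<in> UNIV // \<theta>. card B = 2)"

end

theory Submission imports Defs begin

text \<open>
  A two-uniform congruence \<open>\<theta>\<close> is the same thing as the fixed-point-free involution that
  exchanges the two elements of each block. Since blocks are convex sublattices, an element and its
  partner form a covering pair. Writing \<open>a\<close> and \<open>b\<close> for the involutions of \<open>\<alpha>\<close> and \<open>\<beta>\<close>, the claim
  becomes \<open>a (b x) = b (a x)\<close> for all \<open>x\<close>.

  If both partners of \<open>x\<close> lie above \<open>x\<close> and differ, then both sides equal \<open>sup (a x) (b x)\<close>: joining
  the pair \<open>x, a x\<close> with \<open>b x\<close> shows that this element is the \<open>\<alpha>\<close>-partner of \<open>b x\<close>, and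
  symmetrically (\<open>partners_commute_above\<close>). The case of two lower partners is dual. There remains,
  up to exchanging \<open>\<alpha>\<close> and \<open>\<beta>\<close>, the case \<open>b x < x < a x\<close>. If \<open>a (b x)\<close> lies above \<open>b x\<close>, then both partners of \<open>b x\<close> lie above it, and
  the first case applied to \<open>b x\<close> gives the claim. Otherwise
  \<open>a y < y < b y < a (b y)\<close> with \<open>y = b x\<close>, and such a zigzag can always be prolonged
  (\<open>zigzag_extend\<close>): \<open>y < b y < a (b y) < b (a (b y)) < \<dots>\<close> is an infinite chain. This is the
  only place where finiteness of chains is needed.
\<close>

definition partner :: "('a \<times> 'a) set \<Rightarrow> 'a \<Rightarrow> 'a" where
  "partner \<theta> x = (THE y. (x, y) \<in> \<theta> \<and> y \<noteq> x)"

lemma two_uniform_congruenceD: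
  assumes "two_uniform_congruence \<theta>"
  shows two_uniform_equiv: "equiv UNIV \<theta>"
    and two_uniform_sup: "(x, y) \<in> \<theta> \<Longrightarrow> (sup x z, sup y z) \<in> \<theta>"
    and two_uniform_inf: "(x, y) \<in> \<theta> \<Longrightarrow> (inf x z, inf y z) \<in> \<theta>"
proof -
  show e: "equiv UNIV \<theta>"
    using assms by (simp add: two_uniform_congruence_def lattice_congruence_def)
  have "(z, z) \<in> \<theta>"
    using e by (simp add: equiv_def refl_on_def)
  then show "(x, y) \<in> \<theta> \<Longrightarrow> (sup x z, sup y z) \<in> \<theta>" "(x, y) \<in> \<theta> \<Longrightarrow> (inf x z, inf y z) \<in> \<theta>"
    using assms unfolding two_uniform_congruence_def lattice_congruence_def by blast+
qed

lemma two_uniform_iff: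
  assumes "two_uniform_congruence \<theta>"
  shows "(x, y) \<in> \<theta> \<longleftrightarrow> y = x \<or> y = partner \<theta> x"
    and partner_neq: "partner \<theta> x \<noteq> x"
proof -
  have "x \<in> \<theta> `` {x}"
    using two_uniform_equiv[OF assms] by (simp add: equiv_def refl_on_def)
  moreover have "card (\<theta> `` {x}) = 2"
    using assms by (simp add: two_uniform_congruence_def quotientI)
  ultimately obtain w where w: "\<theta> `` {x} = {x, w}" "w \<noteq> x"
    by (metis card_2_iff doubleton_eq_iff insertE singletonD)
  then have "partner \<theta> x = w"
    unfolding partner_def by (intro the_equality) auto
  then show "(x, y) \<in> \<theta> \<longleftrightarrow> y = x \<or> y = partner \<theta> x" "partner \<theta> x \<noteq> x"
    using w by auto
qed

lemma partner_partner:
  assumes "two_uniform_congruence \<theta>"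
  shows "partner \<theta> (partner \<theta> x) = x"
proof -
  have "(partner \<theta> x, x) \<in> \<theta>"
    using two_uniform_equiv[OF assms] two_uniform_iff(1)[OF assms, of x "partner \<theta> x"]
    by (meson equivE symE)
  then show ?thesis
    using two_uniform_iff[OF assms] by metis
qed

text \<open>The meet of an element with its partner lies in the same block, so it is one of the two.\<close>

lemma partner_comparable:
  assumes "two_uniform_congruence \<theta>"
  shows "x < partner \<theta> x \<or> partner \<theta> x < x"
proof -
  have "(inf x x, inf (partner \<theta> x) x) \<in> \<theta>"
    using two_uniform_inf[OF assms] two_uniform_iff(1)[OF assms] by blast
  then have "inf (partner \<theta> x) x = x \<or> inf (partner \<theta> x) x = partner \<theta> x"
    using two_uniform_iff(1)[OF assms] by simp
  then show ?thesis
    using partner_neq[OF assms, of x] by (metis inf.cobounded1 inf.cobounded2 order_le_less)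
qed

text \<open>Blocks are convex, so nothing lies strictly between an element and its partner.\<close>

lemma partner_covers:
  assumes "two_uniform_congruence \<theta>" "x \<le> y" "y \<le> partner \<theta> x"
  shows "y = x \<or> y = partner \<theta> x"
proof -
  have "(sup x y, sup (partner \<theta> x) y) \<in> \<theta>"
    using two_uniform_sup[OF assms(1)] two_uniform_iff(1)[OF assms(1)] by blast
  then have "(y, partner \<theta> x) \<in> \<theta>"
    using assms(2,3) by (simp add: sup_absorb1 sup_absorb2)
  then show ?thesis
    using two_uniform_iff(1)[OF assms(1)] partner_partner[OF assms(1)] by metis
qed

lemma partner_covers_below:
  assumes "two_uniform_congruence \<theta>" "partner \<theta> x \<le> y" "y \<le> x"
  shows "y = x \<or> y = partner \<theta> x"
  using partner_covers[OF assms(1), of "partner \<theta> x" y] assms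
  by (auto simp: partner_partner)

lemma partner_of_upper_partner:
  assumes "two_uniform_congruence \<alpha>" "two_uniform_congruence \<beta>"
    and "x < partner \<alpha> x" "x < partner \<beta> x" "partner \<alpha> x \<noteq> partner \<beta> x"
  shows "partner \<alpha> (partner \<beta> x) = sup (partner \<alpha> x) (partner \<beta> x)"
proof -
  have "(sup x (partner \<beta> x), sup (partner \<alpha> x) (partner \<beta> x)) \<in> \<alpha>"
    using two_uniform_sup[OF assms(1)] two_uniform_iff(1)[OF assms(1)] by blast
  then have "(partner \<beta> x, sup (partner \<alpha> x) (partner \<beta> x)) \<in> \<alpha>"
    using assms(4) by (simp add: sup_absorb2)
  \<comment> \<open>The join cannot be \<open>partner \<beta> x\<close>: then \<open>partner \<alpha> x\<close> would lie strictly between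
    \<open>x\<close> and \<open>partner \<beta> x\<close>.\<close>
  moreover have "sup (partner \<alpha> x) (partner \<beta> x) \<noteq> partner \<beta> x"
    using partner_covers[OF assms(2), of x "partner \<alpha> x"] assms(3,5)
    by (metis order_less_imp_le order_less_irrefl sup.cobounded1)
  ultimately show ?thesis
    using two_uniform_iff(1)[OF assms(1)] by metis
qed

lemma partners_commute_above:
  assumes "two_uniform_congruence \<alpha>" "two_uniform_congruence \<beta>"
    and "x < partner \<alpha> x" "x < partner \<beta> x"
  shows "partner \<alpha> (partner \<beta> x) = partner \<beta> (partner \<alpha> x)"
proof (cases "partner \<alpha> x = partner \<beta> x")
  case True
  then show ?thesis
    using partner_partner assms(1,2) by metis
next
  case False
  then show ?thesis
    using partner_of_upper_partner[OF assms] partner_of_upper_partner[OF assms(2,1,4,3)]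
    by (simp add: sup_commute)
qed

lemma partner_of_lower_partner:
  assumes "two_uniform_congruence \<alpha>" "two_uniform_congruence \<beta>"
    and "partner \<alpha> x < x" "partner \<beta> x < x" "partner \<alpha> x \<noteq> partner \<beta> x"
  shows "partner \<alpha> (partner \<beta> x) = inf (partner \<alpha> x) (partner \<beta> x)"
proof -
  have "(inf x (partner \<beta> x), inf (partner \<alpha> x) (partner \<beta> x)) \<in> \<alpha>"
    using two_uniform_inf[OF assms(1)] two_uniform_iff(1)[OF assms(1)] by blast
  then have "(partner \<beta> x, inf (partner \<alpha> x) (partner \<beta> x)) \<in> \<alpha>"
    using assms(4) by (simp add: inf_absorb2)
  moreover have "inf (partner \<alpha> x) (partner \<beta> x) \<noteq> partner \<beta> x"
    using partner_covers_below[OF assms(2), of x "partner \<alpha> x"] assms(3,5)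
    by (metis order_less_imp_le order_less_irrefl inf.cobounded1)
  ultimately show ?thesis
    using two_uniform_iff(1)[OF assms(1)] by metis
qed

lemma partners_commute_below:
  assumes "two_uniform_congruence \<alpha>" "two_uniform_congruence \<beta>"
    and "partner \<alpha> x < x" "partner \<beta> x < x"
  shows "partner \<alpha> (partner \<beta> x) = partner \<beta> (partner \<alpha> x)"
proof (cases "partner \<alpha> x = partner \<beta> x")
  case True
  then show ?thesis
    using partner_partner assms(1,2) by metis
next
  case False
  then show ?thesis
    using partner_of_lower_partner[OF assms] partner_of_lower_partner[OF assms(2,1,4,3)]
    by (simp add: inf_commute)
qed

text \<open>
  Put \<open>x = b y\<close> and \<open>q = a x\<close>. If \<open>b q\<close> were below \<open>q\<close>, then both partners of \<open>q\<close> would be below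
  it, so \<open>a\<close> and \<open>b\<close> would commute at \<open>q\<close>; as \<open>b (a q) = b x = y\<close>, this
  means \<open>b q = a y\<close>. Then \<open>b q < y < x < q\<close>, although \<open>q\<close> covers its partner \<open>b q\<close>.
\<close>

lemma zigzag_extend:
  assumes \<alpha>: "two_uniform_congruence \<alpha>" and \<beta>: "two_uniform_congruence \<beta>"
    and "partner \<alpha> y < y" "y < partner \<beta> y" "partner \<beta> y < partner \<alpha> (partner \<beta> y)"
  shows "partner \<alpha> (partner \<beta> y) < partner \<beta> (partner \<alpha> (partner \<beta> y))"
proof (rule ccontr)
  let ?x = "partner \<beta> y"
  let ?q = "partner \<alpha> ?x"
  assume "\<not> ?q < partner \<beta> ?q"
  then have below: "partner \<beta> ?q < ?q"
    using partner_comparable[OF \<beta>] by blast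
  have "partner \<alpha> ?q = ?x"
    using partner_partner[OF \<alpha>] by simp
  then have "partner \<alpha> (partner \<beta> ?q) = y"
    using partners_commute_below[OF \<alpha> \<beta>, of ?q] below assms(5) partner_partner[OF \<beta>] by simp
  then have bq: "partner \<beta> ?q = partner \<alpha> y"
    using partner_partner[OF \<alpha>] by metis
  then have "?x = ?q \<or> ?x = partner \<beta> ?q"
    using partner_covers_below[OF \<beta>, of ?q ?x] assms(3-5) by (auto dest: order_less_imp_le)
  then show False
    using bq assms(3-5) by auto
qed

text \<open>
  Iterating \<open>z \<mapsto> a (b z)\<close> from the start of a zigzag gives a strictly increasing sequence, whose
  range is an infinite chain.
\<close>

lemma no_zigzag:
  fixes \<alpha> \<beta> :: "('a::lattice \<times> 'a) set"
  assumes fin: "\<And>C :: 'a set. Complete_Partial_Order.chain (\<le>) C \<Longrightarrow> finite C"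
    and \<alpha>: "two_uniform_congruence \<alpha>" and \<beta>: "two_uniform_congruence \<beta>"
    and up: "y < partner \<beta> y" "partner \<beta> y < partner \<alpha> (partner \<beta> y)"
  shows "y < partner \<alpha> y"
proof (rule ccontr)
  define Z where
    "Z z \<longleftrightarrow> partner \<alpha> z < z \<and> z < partner \<beta> z \<and> partner \<beta> z < partner \<alpha> (partner \<beta> z)" for z
  define s where "s n = ((\<lambda>z. partner \<alpha> (partner \<beta> z)) ^^ n) y" for n
  assume "\<not> y < partner \<alpha> y"
  then have Zy: "Z y"
    unfolding Z_def using up partner_comparable[OF \<alpha>] by blast
  \<comment> \<open>Prolonging twice, with the two congruences exchanged in between, restores the shape of \<open>Z\<close>.\<close>
  have step: "Z (partner \<alpha> (partner \<beta> z))" if "Z z" for z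
  proof -
    have 1: "partner \<alpha> (partner \<beta> z) < partner \<beta> (partner \<alpha> (partner \<beta> z))"
      using zigzag_extend[OF \<alpha> \<beta>] that unfolding Z_def by blast
    then show ?thesis
      using zigzag_extend[OF \<beta> \<alpha>, of "partner \<beta> z"] that
      unfolding Z_def by (simp add: partner_partner[OF \<alpha>] partner_partner[OF \<beta>])
  qed
  have Zs: "Z (s n)" for n
    by (induction n) (use Zy step in \<open>auto simp: s_def\<close>)
  have "s n < s (Suc n)" for n
    using Zs[of n] by (auto simp: Z_def s_def)
  then have "strict_mono s"
    by (simp add: strict_mono_Suc_iff)
  then have "inj s" "mono s"
    by (simp_all add: strict_mono_imp_inj_on strict_mono_mono)
  have "Complete_Partial_Order.chain (\<le>) (range s)"
    using \<open>mono s\<close> by (auto simp: chain_def) (metis monoD nat_le_linear)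
  then show False
    using fin \<open>inj s\<close> finite_imageD infinite_UNIV_nat by blast
qed

lemma partners_commute_between:
  fixes \<alpha> \<beta> :: "('a::lattice \<times> 'a) set"
  assumes fin: "\<And>C :: 'a set. Complete_Partial_Order.chain (\<le>) C \<Longrightarrow> finite C"
    and \<alpha>: "two_uniform_congruence \<alpha>" and \<beta>: "two_uniform_congruence \<beta>"
    and "partner \<beta> x < x" "x < partner \<alpha> x"
  shows "partner \<alpha> (partner \<beta> x) = partner \<beta> (partner \<alpha> x)"
proof -
  let ?y = "partner \<beta> x"
  have x: "partner \<beta> ?y = x"
    using partner_partner[OF \<beta>] .
  have "?y < partner \<alpha> ?y"
    using no_zigzag[OF fin \<alpha> \<beta>, of ?y] assms(4,5) by (simp add: x)
  then have "partner \<alpha> x = partner \<beta> (partner \<alpha> ?y)"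
    using partners_commute_above[OF \<alpha> \<beta>, of ?y] assms(4) by (simp add: x)
  then show ?thesis
    using partner_partner[OF \<beta>] by metis
qed

lemma partners_commute:
  fixes \<alpha> \<beta> :: "('a::lattice \<times> 'a) set"
  assumes fin: "\<And>C :: 'a set. Complete_Partial_Order.chain (\<le>) C \<Longrightarrow> finite C"
    and \<alpha>: "two_uniform_congruence \<alpha>" and \<beta>: "two_uniform_congruence \<beta>"
  shows "partner \<alpha> (partner \<beta> x) = partner \<beta> (partner \<alpha> x)"
  using partner_comparable[OF \<alpha>, of x] partner_comparable[OF \<beta>, of x]
    partners_commute_above[OF \<alpha> \<beta>, of x] partners_commute_below[OF \<alpha> \<beta>, of x]
    partners_commute_between[OF fin \<alpha> \<beta>, of x] partners_commute_between[OF fin \<beta> \<alpha>, of x]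
  by metis

theorem corollary1p2:
  fixes \<alpha> \<beta> :: "('a::lattice \<times> 'a) set"
  assumes "\<And>C :: 'a set. Complete_Partial_Order.chain (\<le>) C \<Longrightarrow> finite C"
    and "two_uniform_congruence \<alpha>"
    and "two_uniform_congruence \<beta>"
  shows "\<alpha> O \<beta> = \<beta> O \<alpha>"
proof -
  have "(x, z) \<in> \<alpha> O \<beta> \<longleftrightarrow> (x, z) \<in> \<beta> O \<alpha>" for x z
    unfolding relcomp_unfold
    using two_uniform_iff(1)[OF assms(2)] two_uniform_iff(1)[OF assms(3)]
      partners_commute[OF assms, of x]
    by auto
  then show ?thesis
    by auto
qed

end
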